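(* Let $A\in\mathbb{C}^{n\times n}$, $D\in\mathbb{C}^{m\times m}$, $B\in\mathbb{C}^{m\times n}$, $C\in\mathbb{C}^{n\times m}$, and put $S=A-CD^{d}B$, $Z=D-BA^{d}C$, $H=BA^{d}$, $K=A^{d}C$, $\Gamma=HK$, $k=\operatorname{ind}(A)$. If $CD^{d}BA^{\pi}=0$, $KD^{d}Z\Gamma^{d}H=0$, $KD^{\pi}\Gamma^{d}H=0$ and $KD^{d}\Gamma^{\pi}H=0$, then $$S^{d}=(I-K\Gamma^{d}H)A^{d}(I-K\Gamma^{d}H)-\sum_{i=0}^{k-1}A^{i}SK\Gamma^{d}H\bigl(A^{d}(I-K\Gamma^{d}H)\bigr)^{i+2}-\sum_{i=0}^{k-1}A^{i}CD^{d}\Gamma^{\pi}H\bigl(A^{d}(I-K\Gamma^{d}H)\bigr)^{i+1}.$$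
   Context: For a square complex matrix $X$, $\operatorname{ind}(X)$ is the smallest non-negative integer $k$ with $\operatorname{rank}(X^{k})=\operatorname{rank}(X^{k+1})$, and the Drazin inverse $X^{d}$ is the unique matrix with $XX^{d}=X^{d}X$, $X^{d}XX^{d}=X^{d}$, $X^{k}=X^{k+1}X^{d}$ for $k=\operatorname{ind}(X)$. Write $X^{\pi}=I-XX^{d}$. Conventions: $X^{0}=I$ for every square matrix $X$, and $\sum_{i=0}^{k}\ast=0$ if $k<0$. *)

theory Defs
  imports "HOL-Analysis.Analysis"
begin

(* The library's product and power operations on vectors and matrices act componentwise, so powers
   with respect to the matrix product need their own definition. *)
primrec mat_pow :: "complex^'n^'n \<Rightarrow> nat \<Rightarrow> complex^'n^'n" where
  "mat_pow X 0 = mat 1"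
| "mat_pow X (Suc i) = X ** mat_pow X i"

definition mat_index :: "complex^'n^'n \<Rightarrow> nat" where
  "mat_index X = (LEAST k. rank (mat_pow X k) = rank (mat_pow X (k + 1)))"

definition is_drazin_inverse :: "complex^'n^'n \<Rightarrow> complex^'n^'n \<Rightarrow> bool" where
  "is_drazin_inverse X Y \<longleftrightarrow>
     X ** Y = Y ** X \<and>
     Y ** X ** Y = Y \<and>
     mat_pow X (mat_index X) = mat_pow X (mat_index X + 1) ** Y"

(* The description is proper: every square complex matrix has exactly one Drazin inverse. *)
definition drazin :: "complex^'n^'n \<Rightarrow> complex^'n^'n" where
  "drazin X = (THE Y. is_drazin_inverse X Y)"

definition spectral_idem :: "complex^'n^'n \<Rightarrow> complex^'n^'n" where
  "spectral_idem X = mat 1 - X ** drazin X"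

end

theory Submission
  imports Defs
begin

text \<open>
  Write \<open>e = A A\<^sup>d\<close>, \<open>p = 1 - e\<close> and \<open>E = K \<Gamma>\<^sup>d H\<close>, which is an idempotent in the corner ring of \<open>e\<close>.
  The hypothesis \<open>C D\<^sup>d B p = 0\<close> gives \<open>S p = A p\<close>, so \<open>S\<close> is block triangular with respect to
  \<open>1 = e + p\<close>, with nilpotent block \<open>A p\<close> and complementary block \<open>e S e = A (e - W A)\<close>, where
  \<open>W = K D\<^sup>d H\<close>. The remaining hypotheses amount to \<open>W E = W\<close> and \<open>W A E = E\<close>. Hence \<open>W\<close> and \<open>E A E\<close>
  are mutually inverse in the corner ring of \<open>E\<close>, and it follows that \<open>M = (1 - E) A\<^sup>d (1 - E)\<close> is
  the group inverse of \<open>e S e\<close>, with \<open>e S M = M S e = e - E\<close>. The Drazin inverse of the block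
  triangular matrix \<open>S\<close> is then \<open>M + \<Sum>i<k. A\<^sup>i p S M\<^sup>i\<^sup>+\<^sup>2\<close>, and each summand is rewritten with
  \<open>p S M = - S E T - C D\<^sup>d \<Gamma>\<^sup>\<pi> H\<close> for \<open>T = A\<^sup>d (1 - E)\<close>, together with \<open>M\<^sup>i\<^sup>+\<^sup>1 = (1 - E) T\<^sup>i\<^sup>+\<^sup>1\<close>.
\<close>

section \<open>Ring laws and powers for the matrix product\<close>

lemma matrix_sub_ldistrib: "(A :: 'a::ring_1^'n^'m) ** (B - C) = A ** B - A ** C"
  by (simp add: matrix_matrix_mult_def vec_eq_iff right_diff_distrib sum_subtractf)

lemma matrix_sub_rdistrib: "(A - B) ** (C :: 'a::ring_1^'n^'m) = A ** C - B ** C"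
  by (simp add: matrix_matrix_mult_def vec_eq_iff left_diff_distrib sum_subtractf)

lemma matrix_mul_minus:
  "(- A) ** (B :: 'a::ring_1^'n^'m) = - (A ** B)" "C ** (- B) = - (C ** B)"
  by (simp_all add: matrix_matrix_mult_def vec_eq_iff sum_negf)

lemma matrix_add_rdistrib: "(A + B) ** (C :: 'a::semiring_1^'n^'m) = A ** C + B ** C"
  by (simp add: matrix_matrix_mult_def vec_eq_iff distrib_right sum.distrib)

lemmas matrix_mul_distribs =
  matrix_add_ldistrib matrix_add_rdistrib matrix_sub_ldistrib matrix_sub_rdistrib

lemma matrix_mul_0 [simp]:
  "(0 :: 'a::semiring_1^'n^'m) ** (B :: 'a^'p^'n) = 0" "(C :: 'a^'n^'m) ** (0 :: 'a^'p^'n) = 0"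
  by (simp_all add: matrix_matrix_mult_def vec_eq_iff)

lemma matrix_sum_ldistrib: "(A :: 'a::semiring_1^'n^'m) ** (\<Sum>i\<in>I. f i) = (\<Sum>i\<in>I. A ** f i)"
  by (induction I rule: infinite_finite_induct) (simp_all add: matrix_add_ldistrib)

lemma matrix_sum_rdistrib: "(\<Sum>i\<in>I. f i) ** (A :: 'a::semiring_1^'n^'m) = (\<Sum>i\<in>I. f i ** A)"
  by (induction I rule: infinite_finite_induct) (simp_all add: matrix_add_rdistrib)

lemma mat_pow_commute:
  assumes "X ** Y = Y ** X"
  shows "mat_pow X n ** Y = Y ** mat_pow X n"
proof (induction n)
  case (Suc n)
  then show ?case
    by (metis assms mat_pow.simps(2) matrix_mul_assoc)
qed simp

lemma mat_pow_Suc2: "mat_pow X (Suc n) = mat_pow X n ** X"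
  by (simp add: mat_pow_commute)

lemma mat_pow_add: "mat_pow X (m + n) = mat_pow X m ** mat_pow X n"
  by (induction m) (simp_all add: matrix_mul_assoc)

section \<open>Row spaces, rank and factorization\<close>

lemma rows_span_matrix_mul:
  fixes V :: "'a::field^'n^'m"
  shows "rows (V ** A) \<subseteq> vec.span (rows A)"
proof
  fix r assume "r \<in> rows (V ** A)"
  then obtain i where "r = row i (V ** A)"
    by (auto simp: rows_def)
  then have "r = (\<Sum>j\<in>UNIV. (V $ i $ j) *s row j A)"
    by (simp add: row_def matrix_matrix_mult_def vec_eq_iff vector_scalar_mult_def)
  also have "\<dots> \<in> vec.span (rows A)"
    by (intro vec.span_sum vec.span_scale vec.span_base) (auto simp: rows_def)
  finally show "r \<in> vec.span (rows A)" .
qed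

lemma rank_matrix_mul_le:
  fixes V :: "'a::field^'n^'m"
  shows "rank (V ** A) \<le> rank A"
  unfolding row_rank_def_gen
  by (metis rows_span_matrix_mul vec.dim_span vec.dim_subset)

text \<open>The row space of \<open>M\<close> is the image of \<open>v v* M\<close>, so every row of
  \<open>N\<close> has a coefficient vector; these vectors are the rows of \<open>V\<close>.\<close>

lemma left_factor_if_rows_span:
  fixes M :: "'a::field^'p^'n" and N :: "'a^'p^'m"
  assumes "rows N \<subseteq> vec.span (rows M)"
  obtains V where "N = V ** M"
proof -
  have "vec.subspace (range (\<lambda>v. v v* M))"
  proof (rule vec.subspaceI)
    show "0 \<in> range (\<lambda>v. v v* M)"
      by (metis rangeI vector_matrix_mult_0)
  next
    fix x y assume "x \<in> range (\<lambda>v. v v* M)" "y \<in> range (\<lambda>v. v v* M)"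
    then show "x + y \<in> range (\<lambda>v. v v* M)"
      by (auto simp flip: vector_matrix_left_distrib intro: rangeI)
  next
    fix c x assume "x \<in> range (\<lambda>v. v v* M)"
    then obtain v where "x = v v* M" by blast
    then have "c *s x = (c *s v) v* M"
      by (simp add: vec_eq_iff vector_matrix_mult_def sum_distrib_left mult_ac)
    then show "c *s x \<in> range (\<lambda>v. v v* M)" by blast
  qed
  moreover have "rows M \<subseteq> range (\<lambda>v. v v* M)"
  proof
    fix r assume "r \<in> rows M"
    then obtain i where "r = row i M"
      by (auto simp: rows_def)
    then have "r = axis i 1 v* M"
      by (simp add: row_def vector_matrix_mult_def axis_def vec_eq_iff if_distrib if_distribR cong: if_cong)
    then show "r \<in> range (\<lambda>v. v v* M)" by blast
  qed
  ultimately have "rows N \<subseteq> range (\<lambda>v. v v* M)"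
    using assms vec.span_minimal by blast
  then have "\<forall>i. \<exists>v. row i N = v v* M"
    by (auto simp: rows_def)
  then obtain v where v: "\<And>i. row i N = v i v* M"
    by metis
  have "N = (\<chi> i. v i) ** M"
    using v by (simp add: vec_eq_iff row_def matrix_matrix_mult_def vector_matrix_mult_def mult.commute)
  then show thesis by (rule that)
qed

lemma left_factor_if_rank_eq:
  fixes V :: "'a::field^'n^'n" and M :: "'a^'p^'n"
  assumes "rank (V ** M) = rank M"
  obtains W where "M = W ** (V ** M)"
proof -
  have "vec.span (rows (V ** M)) = vec.span (rows M)"
  proof (rule vec.subspace_dim_equal)
    show "vec.span (rows (V ** M)) \<subseteq> vec.span (rows M)"
      using rows_span_matrix_mul[of V M] by (simp add: vec.span_minimal)
  qed (use assms in \<open>simp_all add: row_rank_def_gen\<close>)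
  then have "rows M \<subseteq> vec.span (rows (V ** M))"
    by (simp add: vec.span_superset)
  then show thesis
    using left_factor_if_rows_span that by blast
qed

text \<open>The hypothesis makes \<open>P\<close> injective, hence surjective, on its own range.\<close>
lemma right_factor_square:
  fixes P W :: "'a::field^'n^'n"
  assumes "P = W ** (P ** P)"
  obtains U where "P = P ** P ** U"
proof -
  let ?R = "range ((*v) P)"
  have lin: "Vector_Spaces.linear (*s) (*s) ((*v) P)"
    by (simp add: matrix_vector_mul_linear_gen)
  have sub: "vec.subspace ?R"
    using vec.linear_subspace_image[OF lin] by (simp add: vec.subspace_UNIV)
  have inj: "inj_on ((*v) P) ?R"
  proof (rule inj_onI, clarify)
    fix x y assume "P *v (P *v x) = P *v (P *v y)"
    then show "P *v x = P *v y"
      by (metis assms matrix_vector_mul_assoc)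
  qed
  have "vec.dim ((*v) P ` ?R) = vec.dim ?R"
    using sub inj vec.dim_image_eq[OF lin] by (metis vec.span_eq_iff)
  then have "(*v) P ` ?R = ?R"
    using sub vec.linear_subspace_image[OF lin sub]
    by (intro vec.subspace_dim_equal) auto
  then have "\<forall>i. \<exists>x. P *v axis i 1 = P *v (P *v x)"
    by (metis (no_types, lifting) imageE rangeI)
  then obtain u where u: "\<And>i. P *v axis i 1 = P *v (P *v u i)"
    by metis
  have "column i P = column i (P ** P ** transpose (\<chi> i. u i))" for i
  proof -
    have "column i P = P *v axis i 1" 
      by (simp add: column_def matrix_vector_mult_def axis_def vec_eq_iff if_distrib cong: if_cong)
    also have "\<dots> = (P ** P) *v u i"
      by (simp add: u matrix_vector_mul_assoc)
    also have "\<dots> = column i (P ** P ** transpose (\<chi> i. u i))"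
      by (simp add: column_def matrix_vector_mult_def matrix_matrix_mult_def transpose_def vec_eq_iff)
    finally show ?thesis .
  qed
  then have "P = P ** P ** transpose (\<chi> i. u i)"
    by (simp add: column_def vec_eq_iff)
  then show thesis by (rule that)
qed

section \<open>Index, uniqueness and existence of the Drazin inverse\<close>

lemma rank_mat_pow_index: "rank (mat_pow X (mat_index X)) = rank (mat_pow X (mat_index X + 1))"
proof -
  have "\<exists>k. rank (mat_pow X k) = rank (mat_pow X (k + 1))"
  proof (rule ccontr)
    assume neq: "\<nexists>k. rank (mat_pow X k) = rank (mat_pow X (k + 1))"
    \<comment> \<open>If the ranks never stabilized, every further power would lose at least one
      unit of rank.\<close>
    have "rank (mat_pow X k) + k \<le> rank (mat_pow X 0)" for k
    proof (induction k)
      case (Suc k)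
      have "rank (mat_pow X (k + 1)) < rank (mat_pow X k)"
        using neq rank_matrix_mul_le[of X "mat_pow X k"]
        by (metis Suc_eq_plus1 le_neq_implies_less mat_pow.simps(2))
      with Suc show ?case by simp
    qed simp
    from this[of "rank (mat_pow X 0) + 1"] show False by simp
  qed
  then show ?thesis
    unfolding mat_index_def by (rule LeastI_ex)
qed

lemma mat_pow_index_left_factor:
  obtains V where "mat_pow X (mat_index X) = V ** mat_pow X (mat_index X + n)"
proof -
  let ?j = "mat_index X"
  obtain W where W: "mat_pow X ?j = W ** mat_pow X (?j + 1)"
    using rank_mat_pow_index[of X] left_factor_if_rank_eq[of X "mat_pow X ?j"] by auto
  have "\<exists>V. mat_pow X ?j = V ** mat_pow X (?j + n)"
  proof (induction n)
    case 0
    show ?case by (rule exI[of _ "mat 1"]) simp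
  next
    case (Suc n)
    then obtain V where "mat_pow X ?j = V ** mat_pow X (?j + n)" ..
    also have "mat_pow X (?j + n) = W ** mat_pow X (?j + Suc n)"
      using W by (simp add: mat_pow_add matrix_mul_assoc)
    finally show ?case
      by (metis matrix_mul_assoc)
  qed
  then show thesis using that by blast
qed

text \<open>\<open>X ** Y\<close> is idempotent and equals the product of the two powers for
  positive \<open>n\<close>; the extra factor also covers \<open>n = 0\<close>.\<close>

lemma mat_pow_mult_idem:
  assumes "X ** Y = Y ** X" "Y ** X ** Y = Y"
  shows "mat_pow X n ** mat_pow Y n ** (X ** Y) = X ** Y"
proof (induction n)
  case (Suc n)
  have "mat_pow X (Suc n) ** mat_pow Y (Suc n) ** (X ** Y)
      = X ** (mat_pow X n ** mat_pow Y n ** (X ** Y)) ** Y"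
    by (metis assms(1) mat_pow.simps(2) mat_pow_Suc2 mat_pow_commute matrix_mul_assoc)
  with Suc assms show ?case
    by (metis matrix_mul_assoc)
qed simp

text \<open>Spares computing the index: the power identity at any \<open>m\<close> forces equal
  ranks there, so \<open>m\<close> is at least the index, and a left factor carries the identity
  down to the index.\<close>

lemma is_drazin_inverseI:
  assumes "X ** Y = Y ** X" "Y ** X ** Y = Y" "mat_pow X m = mat_pow X (m + 1) ** Y"
  shows "is_drazin_inverse X Y"
proof -
  let ?j = "mat_index X"
  have "mat_pow X (m + 1) ** Y = Y ** (X ** mat_pow X m)"
    using mat_pow_commute[OF assms(1)] by (metis mat_pow.simps(2) Suc_eq_plus1)
  then have "rank (mat_pow X m) \<le> rank (mat_pow X (m + 1))"
    using assms(3) rank_matrix_mul_le by (metis mat_pow.simps(2) Suc_eq_plus1)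
  then have "rank (mat_pow X m) = rank (mat_pow X (m + 1))"
    using rank_matrix_mul_le[of X "mat_pow X m"] by simp
  then have "?j \<le> m"
    unfolding mat_index_def by (rule Least_le)
  then obtain V where "mat_pow X ?j = V ** mat_pow X m"
    using mat_pow_index_left_factor[of X "m - ?j"] by auto
  then have "mat_pow X ?j = mat_pow X (?j + 1) ** Y"
    using assms(3) by (metis Suc_eq_plus1 mat_pow_Suc2 matrix_mul_assoc)
  with assms show ?thesis
    by (simp add: is_drazin_inverse_def)
qed

text \<open>The idempotents \<open>X ** Y\<close> and \<open>X ** Y'\<close> both fix the power of
  \<open>X\<close> at its index, so evaluating their product in two ways identifies them; then
  \<open>Y = Y ** X ** Y\<close> gives the claim.\<close>

lemma is_drazin_inverse_unique:
  assumes "is_drazin_inverse X Y" "is_drazin_inverse X Y'"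
  shows "Y = Y'"
proof -
  let ?k = "mat_index X"
  note D = assms[unfolded is_drazin_inverse_def]
  have 1: "mat_pow X ?k ** (X ** Y) = mat_pow X ?k" "mat_pow X ?k ** (X ** Y') = mat_pow X ?k"
    using D by (metis Suc_eq_plus1 mat_pow_Suc2 matrix_mul_assoc)+
  have com: "mat_pow X ?k ** (X ** Y) = (X ** Y) ** mat_pow X ?k"
    by (rule mat_pow_commute) (metis D matrix_mul_assoc)
  have "X ** Y ** (X ** Y') = X ** Y"
  proof -
    have "X ** Y = mat_pow Y ?k ** mat_pow X ?k ** (X ** Y)"
      using D mat_pow_mult_idem by (metis mat_pow_commute)
    also have "\<dots> = mat_pow Y ?k ** mat_pow X ?k"
      by (simp add: 1 flip: matrix_mul_assoc)
    finally show ?thesis by (metis 1(2) matrix_mul_assoc)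
  qed
  moreover have "X ** Y ** (X ** Y') = X ** Y'"
  proof -
    have "X ** Y' = mat_pow X ?k ** (mat_pow Y' ?k ** (X ** Y'))"
      using D mat_pow_mult_idem by (metis matrix_mul_assoc)
    then show ?thesis by (metis 1(1) com matrix_mul_assoc)
  qed
  ultimately have "X ** Y = X ** Y'" by simp
  then show ?thesis
    using D by (metis matrix_mul_assoc)
qed

lemma is_drazin_inverse_exists:
  fixes X :: "complex^'n^'n"
  shows "\<exists>Y. is_drazin_inverse X Y"
proof -
  let ?m = "mat_index X"
  define P where "P = mat_pow X ?m"
  have XP: "P ** X = X ** P"
    unfolding P_def by (rule mat_pow_commute) simp
  have XP': "P ** (X ** T) = X ** (P ** T)" for T :: "complex^'n^'n"
    using XP by (metis matrix_mul_assoc)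
  obtain V1 where V1: "P = V1 ** (X ** P)"
    using mat_pow_index_left_factor[of X 1]
    by (metis P_def Suc_eq_plus1 mat_pow.simps(2))
  \<comment> \<open>Two powers beyond twice the index: one \<open>X\<close> goes into
    \<open>V\<close>, the other leaves \<open>V\<close> a left inverse of \<open>X ** P\<close> on
    \<open>P\<close>.\<close>
  obtain V2 where V2: "P = V2 ** (X ** (X ** (P ** P)))"
    using mat_pow_index_left_factor[of X "Suc (Suc ?m)"]
    by (metis P_def add_Suc_right mat_pow.simps(2) mat_pow_add)
  define V where "V = V2 ** X"
  have V: "V ** (X ** (P ** P)) = P"
    using V2 by (simp add: V_def matrix_mul_assoc)
  have VT: "V ** (X ** (P ** (P ** T))) = P ** T" for T :: "complex^'n^'n"
    using V by (metis matrix_mul_assoc)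
  have "X ** P = X ** V2 ** ((X ** P) ** (X ** P))"
    by (subst V2) (simp add: XP' flip: matrix_mul_assoc)
  then obtain U where U: "X ** P = X ** P ** (X ** P) ** U"
    by (rule right_factor_square)
  \<comment> \<open>\<open>V1\<close> cancels the leading \<open>X\<close> from
    \<open>U\<close>.\<close>
  have PU: "P = X ** (P ** (P ** U))"
  proof -
    have "P = V1 ** (X ** P ** (X ** P) ** U)"
      using V1 U by metis
    also have "\<dots> = V1 ** (X ** P) ** (X ** (P ** U))"
      by (simp add: matrix_mul_assoc)
    also have "\<dots> = X ** (P ** (P ** U))"
      by (simp add: XP' flip: V1)
    finally show ?thesis .
  qed
  \<comment> \<open>The left and right candidates agree, so factors can be moved from one side to
    the other.\<close>
  have VP: "V ** P = P ** U"
    by (subst PU) (simp add: VT)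
  have VPT: "V ** (P ** T) = P ** (U ** T)" for T :: "complex^'n^'n"
    using VP by (metis matrix_mul_assoc)
  have "P ** U ** X = V ** (X ** P)"
    by (simp add: XP flip: VP matrix_mul_assoc)
  also have "\<dots> = V ** (X ** (X ** (P ** (P ** U))))"
    by (subst PU) simp
  also have "\<dots> = V ** (X ** (P ** (P ** (X ** U))))"
    by (simp add: XP')
  also have "\<dots> = X ** (P ** U)"
    by (simp add: VT) (simp add: XP')
  finally have com: "X ** (P ** U) = P ** U ** X" ..
  have "P ** U ** X ** (P ** U) = P ** U"
    by (simp add: VT XP' flip: VPT matrix_mul_assoc)
  moreover have "mat_pow X ?m = mat_pow X (?m + 1) ** (P ** U)"
    using PU by (simp add: P_def[symmetric] flip: matrix_mul_assoc)
  ultimately have "is_drazin_inverse X (P ** U)"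
    using com by (simp add: is_drazin_inverse_def)
  then show ?thesis ..
qed

lemma is_drazin_inverse_drazin: "is_drazin_inverse X (drazin X)"
  unfolding drazin_def
  by (metis is_drazin_inverse_exists is_drazin_inverse_unique theI)

lemma drazin_eqI:
  assumes "X ** Y = Y ** X" "Y ** X ** Y = Y" "mat_pow X m = mat_pow X (m + 1) ** Y"
  shows "drazin X = Y"
  using is_drazin_inverse_drazin is_drazin_inverse_unique is_drazin_inverseI[OF assms] by blast


section \<open>Corner rings and block triangular matrices\<close>

text \<open>Lets the simplifier apply an equation for a product inside a right-nested product.\<close>
lemma matrix_mul_eq_assoc: "X ** Y = R \<Longrightarrow> X ** (Y ** T) = R ** T"
  by (simp add: matrix_mul_assoc)

text \<open>In the corner ring of \<open>E\<close>, the element \<open>E W E\<close> is a left inverse of \<open>E A E\<close>; since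
  one-sided inverses of square matrices are two-sided (after adding \<open>1 - E\<close>), it is also a right one.\<close>
lemma idempotent_one_sided_inverse:
  fixes E W A :: "'a::field^'n^'n"
  assumes E: "E ** E = E" and WE: "W ** E = W" and WAE: "W ** A ** E = E"
  shows "E ** W = W" "E ** A ** W = E"
proof -
  have [simp]: "E ** (E ** T) = E ** T" "W ** (E ** T) = W ** T" "W ** (A ** (E ** T)) = E ** T"
    "W ** (A ** E) = E" for T :: "'a^'n^'n"
    using assms by (metis matrix_mul_assoc)+
  note [simp] = E WE
  let ?X = "E ** W + (mat 1 - E)" and ?Y = "E ** (A ** E) + (mat 1 - E)"
  have "?X ** ?Y = mat 1"
    by (simp add: matrix_mul_distribs flip: matrix_mul_assoc)
  then have "?Y ** ?X = mat 1"
    by (rule matrix_left_right_inverse1)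
  then have 1: "E ** (A ** (E ** W)) = E"
    by (simp add: matrix_mul_distribs flip: matrix_mul_assoc)
  then have "W ** (E ** (A ** (E ** W))) = W"
    by simp
  then show 2: "E ** W = W" by simp
  show "E ** A ** W = E" using 1 by (simp add: 2 flip: matrix_mul_assoc)
qed

text \<open>With respect to \<open>1 = e + p\<close> the matrix \<open>S\<close> is block triangular, with nilpotent block \<open>A p\<close>
  and a block \<open>e S e\<close> whose group inverse is \<open>M\<close>. The sum \<open>L\<close> is the off-diagonal block: it solves
  the Sylvester equation \<open>L S e = p S M + A L\<close>, by telescoping.\<close>
lemma drazin_nilpotent_perturbation:
  fixes S A M E e p :: "complex^'n^'n"
  assumes e: "e ** e = e" and p: "p = mat 1 - e" and Ae: "A ** e = e ** A"
    and nil: "mat_pow A k ** p = 0" and Sp: "S ** p = A ** p"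
    and E: "e ** E = E" "E ** e = E" and M: "e ** M = M" "M ** e = M" "M ** E = 0" "E ** M = 0"
    and eSM: "e ** S ** M = e - E" and MSe: "M ** S ** e = e - E" and eSE: "e ** S ** E = 0"
  shows "drazin S = M + (\<Sum>i<k. mat_pow A i ** p ** S ** mat_pow M (i + 2))"
proof -
  \<comment> \<open>The telescoping sequence: \<open>f 0\<close> is \<open>p ** S ** M\<close>, and
    \<open>f k\<close> vanishes by \<open>nil\<close>.\<close>
  define f where "f i = mat_pow A i ** (p ** (S ** mat_pow M (i + 1)))" for i
  define L where "L = (\<Sum>i<k. mat_pow A i ** (p ** (S ** mat_pow M (i + 2))))"
  have [simp]: "p ** e = 0" "e ** p = 0" "p ** p = p"
    using e by (simp_all add: p matrix_mul_distribs)
  have Ap: "A ** p = p ** A"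
    using Ae by (simp add: p matrix_mul_distribs)
  have powAe: "mat_pow A i ** e = e ** mat_pow A i" and powAp: "mat_pow A i ** p = p ** mat_pow A i" for i
    by (simp_all add: mat_pow_commute Ae Ap)
  have powM: "mat_pow M (Suc i) ** e = mat_pow M (Suc i)" "mat_pow M (Suc i) ** E = 0"
    "mat_pow M (Suc (Suc i)) ** (S ** e) = mat_pow M (Suc i)" for i
    using MSe unfolding mat_pow_Suc2 by (simp_all add: M matrix_mul_distribs flip: matrix_mul_assoc)
  have eL: "e ** L = 0"
    unfolding L_def matrix_sum_ldistrib
    by (rule sum.neutral) (simp add: matrix_mul_assoc flip: powAe, simp flip: matrix_mul_assoc)
  then have pL: "p ** L = L"
    by (simp add: p matrix_mul_distribs)
  have Le: "L ** e = L" and LE: "L ** E = 0"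
    unfolding L_def matrix_sum_rdistrib
    using powM by (simp_all flip: matrix_mul_assoc)
  have EL: "E ** L = 0"
    using E eL by (metis matrix_mul_assoc matrix_mul_0(2))
  have LAp: "L ** (A ** p) = 0"
    by (metis Ap Le matrix_mul_assoc matrix_mul_0 \<open>e ** p = 0\<close>)
  have LAL: "L ** (A ** L) = 0"
    by (metis LAp matrix_mul_assoc matrix_mul_0(1) pL)
  have SL: "S ** L = A ** L"
    by (metis Sp matrix_mul_assoc pL)
  have split: "T = e ** T + p ** T" "U = U ** e + U ** p" for T U :: "complex^'n^'n"
    by (simp_all add: p matrix_mul_distribs)
  have SM: "S ** M = e - E + p ** S ** M"
    using split(1)[of "S ** M"] eSM by (metis matrix_mul_assoc)
  have "M ** S ** p = 0"
    by (metis M(2) Sp Ap matrix_mul_assoc matrix_mul_0 \<open>e ** p = 0\<close>)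
  then have MS: "M ** S = e - E"
    using split(2)[of "M ** S"] MSe by (metis add_0_right)
  have LS: "L ** S = p ** S ** M + A ** L"
  proof -
    have "L ** S = L ** (S ** e)"
      using split(2)[of "L ** S"] LAp Sp by (metis add_0_right matrix_mul_assoc)
    also have "\<dots> = (\<Sum>i<k. f i)"
      unfolding L_def matrix_sum_rdistrib f_def
      using powM(3) by (simp flip: matrix_mul_assoc)
    also have "\<dots> = f 0 - f k + (\<Sum>i<k. f (Suc i))"
      using sum_lessThan_telescope'[of f k] by (simp add: sum_subtractf diff_eq_eq)
    also have "f k = 0"
      using nil by (simp add: f_def matrix_mul_assoc)
    also have "(\<Sum>i<k. f (Suc i)) = A ** L"
      by (simp add: f_def L_def matrix_sum_ldistrib flip: matrix_mul_assoc)
    finally show ?thesis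
      by (simp add: f_def matrix_mul_assoc)
  qed
  let ?Y = "M + L"
  have SY: "S ** ?Y = e - E + L ** S" and YS: "?Y ** S = e - E + L ** S"
    by (simp_all add: matrix_mul_distribs SM MS SL LS)
  \<comment> \<open>Insert \<open>L = L ** e\<close>, then use \<open>eSM\<close> and
    \<open>LE\<close>.\<close>
  have "L ** (S ** M) = L"
    by (metis LE Le eSM matrix_mul_assoc matrix_sub_ldistrib diff_zero)
  then have YSY: "?Y ** S ** ?Y = ?Y"
    unfolding YS by (simp add: matrix_mul_distribs M eL EL SL LAL flip: matrix_mul_assoc)
  \<comment> \<open>The leading \<open>S\<close> is essential: \<open>mat 1 - ?Y ** S\<close>
    contains \<open>E\<close>, which \<open>S\<close> maps into the range of \<open>p\<close> by
    \<open>eSE\<close>. On that range \<open>S\<close> acts as \<open>A\<close>, so \<open>k\<close>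
    further powers annihilate \<open>R\<close>; hence the exponent \<open>Suc k\<close>
    below.\<close>
  define R where "R = S ** (mat 1 - ?Y ** S)"
  have "S ** E = p ** S ** E"
    using split(1)[of "S ** E"] eSE by (metis add_0_left matrix_mul_assoc)
  moreover have "R = S ** (p + E - L ** S)"
    unfolding R_def YS by (simp add: p algebra_simps)
  ultimately have "R = A ** p + p ** S ** E - A ** L ** S"
    by (simp add: Sp matrix_mul_distribs SL matrix_mul_assoc)
  moreover have "p ** (A ** (L ** T)) = A ** (L ** T)" for T :: "complex^'n^'n"
    by (metis Ap matrix_mul_assoc pL)
  moreover have "p ** (p ** T) = p ** T" "p ** (A ** p) = A ** p" for T :: "complex^'n^'n"
    using Ap \<open>p ** p = p\<close> by (metis matrix_mul_assoc)+
  ultimately have pR: "p ** R = R"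
    by (simp add: matrix_mul_distribs flip: matrix_mul_assoc)
  have "mat_pow S i ** R = mat_pow A i ** R" for i
  proof (induction i)
    case (Suc i)
    have "mat_pow S (Suc i) ** R = S ** (p ** (mat_pow A i ** R))"
      using Suc powAp pR by (metis mat_pow.simps(2) matrix_mul_assoc)
    also have "\<dots> = mat_pow A (Suc i) ** R"
      using Sp powAp pR by (metis mat_pow.simps(2) matrix_mul_assoc)
    finally show ?case .
  qed simp
  then have "mat_pow S k ** R = 0"
    using nil pR by (metis matrix_mul_assoc matrix_mul_0(1))
  then have "mat_pow S (Suc k) ** (mat 1 - S ** ?Y) = 0"
    unfolding R_def SY YS mat_pow_Suc2 by (simp flip: matrix_mul_assoc)
  then have "mat_pow S (Suc k) = mat_pow S (Suc k + 1) ** ?Y"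
    unfolding matrix_sub_ldistrib by (simp add: matrix_mul_assoc mat_pow_Suc2 del: mat_pow.simps(2))
  then have "drazin S = ?Y"
    by (rule drazin_eqI[OF SY[folded YS] YSY])
  then show ?thesis
    by (simp add: L_def matrix_mul_assoc)
qed

section \<open>Schur complement: verification of the block data\<close>

theorem theorem2p14:
  fixes A S :: "complex^'n^'n"
    and D Z \<Gamma> :: "complex^'m^'m"
    and B H :: "complex^'n^'m"
    and C K :: "complex^'m^'n"
    and k :: nat
  assumes S: "S = A - C ** drazin D ** B"
    and Z: "Z = D - B ** drazin A ** C"
    and H: "H = B ** drazin A"
    and K: "K = drazin A ** C"
    and \<Gamma>: "\<Gamma> = H ** K"
    and k: "k = mat_index A"
    and "C ** drazin D ** B ** spectral_idem A = 0"
    and "K ** drazin D ** Z ** drazin \<Gamma> ** H = 0"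
    and "K ** spectral_idem D ** drazin \<Gamma> ** H = 0"
    and "K ** drazin D ** spectral_idem \<Gamma> ** H = 0"
  shows "drazin S =
      (mat 1 - K ** drazin \<Gamma> ** H) ** drazin A ** (mat 1 - K ** drazin \<Gamma> ** H)
    - (\<Sum>i<k. mat_pow A i ** S ** K ** drazin \<Gamma> ** H **
               mat_pow (drazin A ** (mat 1 - K ** drazin \<Gamma> ** H)) (i + 2))
    - (\<Sum>i<k. mat_pow A i ** C ** drazin D ** spectral_idem \<Gamma> ** H **
               mat_pow (drazin A ** (mat 1 - K ** drazin \<Gamma> ** H)) (i + 1))"
proof -
  define a d g where "a = drazin A" and "d = drazin D" and "g = drazin \<Gamma>"
  define e p where "e = A ** a" and "p = mat 1 - e"
  define E where "E = K ** (g ** H)"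
  define W where "W = K ** (d ** H)"
  define N where "N = C ** (d ** (spectral_idem \<Gamma> ** H))"
  define T where "T = a ** (mat 1 - E)"
  define M where "M = (mat 1 - E) ** T"
  have hyps: "C ** (d ** (B ** p)) = 0" "K ** (d ** (Z ** (g ** H))) = 0"
    "K ** (spectral_idem D ** (g ** H)) = 0" "K ** (d ** (spectral_idem \<Gamma> ** H)) = 0"
    using assms(7-10)
    by (simp_all add: a_def d_def g_def e_def p_def spectral_idem_def matrix_mul_assoc)
  have Aa: "A ** a = a ** A" "a ** A ** a = a" "mat_pow A k = mat_pow A (k + 1) ** a"
    using is_drazin_inverse_drazin[of A] by (simp_all add: is_drazin_inverse_def a_def k)
  have Dd: "D ** d = d ** D"
    using is_drazin_inverse_drazin[of D] by (simp_all add: is_drazin_inverse_def d_def)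
  have Gg: "\<Gamma> ** g = g ** \<Gamma>" "g ** \<Gamma> ** g = g"
    using is_drazin_inverse_drazin[of \<Gamma>] by (simp_all add: is_drazin_inverse_def g_def)
  have ea: "e ** a = a" "a ** e = a" and e: "e ** e = e" and Ae: "A ** e = e ** A"
    unfolding e_def using Aa by (metis matrix_mul_assoc)+
  have nil: "mat_pow A k ** p = 0"
    using Aa(3) by (simp add: p_def e_def matrix_mul_distribs mat_pow_Suc2 matrix_mul_assoc del: mat_pow.simps(2))
  have Ka: "K = a ** C" and Ha: "H = B ** a"
    by (simp_all add: K H a_def)
  have eK: "e ** K = K" and He: "H ** e = H"
    unfolding Ka Ha using ea by (metis matrix_mul_assoc)+
  have eC: "e ** C = A ** K" and Be: "B ** e = H ** A"
    unfolding Ka Ha e_def using Aa(1) by (metis matrix_mul_assoc)+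
  \<comment> \<open>This identity brings in \<open>Z\<close>: it turns \<open>W ** A ** E\<close>
    into an expression in \<open>D - Z\<close>.\<close>
  have "H ** (A ** K) = B ** a ** C"
    unfolding Ka Ha using Aa(2) by (metis matrix_mul_assoc)
  then have HAK: "H ** (A ** K) = D - Z"
    by (simp add: Z a_def)
  have eE: "e ** E = E" and Ee: "E ** e = E"
    unfolding E_def using eK He by (metis matrix_mul_assoc)+
  have EE: "E ** E = E"
    unfolding E_def using Gg \<Gamma> by (metis matrix_mul_assoc)
  \<comment> \<open>Through this identity the hypothesis on \<open>spectral_idem \<Gamma>\<close>
    becomes \<open>W ** E = W\<close>.\<close>
  have HE: "H - H ** E = spectral_idem \<Gamma> ** H"
    by (simp add: E_def spectral_idem_def \<Gamma> g_def matrix_mul_distribs matrix_mul_assoc)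
  have "W - W ** E = K ** (d ** (H - H ** E))"
    by (simp add: W_def matrix_mul_distribs flip: matrix_mul_assoc)
  then have WE: "W ** E = W"
    by (simp add: HE hyps)
  have "W ** A ** E = K ** (d ** (H ** (A ** K) ** (g ** H)))"
    by (simp add: W_def E_def flip: matrix_mul_assoc)
  also have "\<dots> = K ** (D ** d ** (g ** H))"
    by (simp add: HAK hyps Dd matrix_mul_distribs matrix_mul_assoc flip: matrix_mul_assoc)
  also have "\<dots> = E"
    using hyps(3) by (simp add: spectral_idem_def E_def matrix_mul_distribs d_def)
  finally have WAE: "W ** A ** E = E" .
  note EW = idempotent_one_sided_inverse[OF EE WE WAE]
  \<comment> \<open>The first hypothesis allows \<open>B\<close> to be replaced by
    \<open>B ** e\<close>; then \<open>eC\<close> and \<open>Be\<close> produce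
    \<open>A ** (W ** A)\<close>.\<close>
  have "e ** (C ** (d ** B)) = e ** (C ** (d ** (B ** e)))"
    using hyps(1) by (simp add: p_def matrix_mul_distribs)
  then have eS: "e ** S = e ** A - A ** (W ** A)"
    by (simp add: S d_def[symmetric] matrix_mul_distribs W_def Be eC matrix_mul_eq_assoc[OF eC] flip: matrix_mul_assoc)
  have eSE: "e ** S ** E = 0"
    unfolding eS using WAE eE by (simp add: matrix_mul_distribs flip: matrix_mul_assoc Ae)
  have eN: "e ** N = 0"
    by (simp add: N_def matrix_mul_eq_assoc[OF eC] hyps flip: matrix_mul_assoc)
  have "S ** a = e - C ** (d ** H)"
    by (simp add: S H e_def d_def a_def matrix_mul_distribs matrix_mul_assoc)
  then have "S ** T = e - E - C ** (d ** (H - H ** E))"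
    by (simp add: T_def matrix_mul_assoc) (simp add: matrix_mul_distribs eE flip: matrix_mul_assoc)
  then have ST: "S ** T = e - E - N"
    by (simp add: HE N_def)
  have "e ** S ** M = e ** (S ** T) - e ** S ** E ** T"
    by (simp add: M_def matrix_mul_distribs matrix_mul_assoc)
  then have eSM: "e ** S ** M = e - E"
    by (simp add: eSE ST matrix_mul_distribs e eE eN)
  have EaM: "E ** M = 0" and ME: "M ** E = 0" and TE: "T ** E = 0"
    by (simp_all add: M_def T_def matrix_mul_distribs EE matrix_mul_eq_assoc[OF EE] flip: matrix_mul_assoc)
  have eM: "e ** M = M" and Me: "M ** e = M"
    by (simp_all add: M_def T_def matrix_mul_distribs eE Ee ea matrix_mul_eq_assoc[OF eE]
        matrix_mul_eq_assoc[OF ea(1)] flip: matrix_mul_assoc)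
  let ?V = "e - W ** A"
  have eW: "e ** W = W" and We: "W ** e = W"
    using EW(1) WE eE Ee by (metis matrix_mul_assoc)+
  have "e ** (S ** e) = A ** ?V"
    using eS Ae We by (simp add: matrix_mul_distribs e matrix_mul_assoc) (metis e matrix_mul_assoc)
  then have "M ** S ** e = (mat 1 - E) ** (a ** ((mat 1 - E) ** (A ** ?V)))"
    by (metis M_def Me T_def matrix_mul_assoc)
  \<comment> \<open>\<open>E ** (A ** ?V)\<close> vanishes because
    \<open>E ** A ** W = E\<close>.\<close>
  also have "(mat 1 - E) ** (A ** ?V) = A ** ?V"
    using EW(2) Ee Ae by (simp add: matrix_mul_distribs) (metis matrix_mul_assoc)
  also have "a ** (A ** ?V) = ?V"
  proof -
    have "e ** ?V = ?V"
      by (simp add: matrix_mul_distribs e eW matrix_mul_eq_assoc[OF eW])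
    then show ?thesis
      by (metis Aa(1) e_def matrix_mul_assoc)
  qed
  also have "(mat 1 - E) ** ?V = e - E"
    using EW(1) Ee by (simp add: matrix_mul_distribs matrix_mul_assoc)
  finally have MSe: "M ** S ** e = e - E" .
  have Sp: "S ** p = A ** p"
    using hyps(1) by (simp add: S d_def matrix_mul_distribs flip: matrix_mul_assoc)
  \<comment> \<open>Since \<open>T ** E = 0\<close>, all factors \<open>mat 1 - E\<close> but the
    first are absorbed.\<close>
  have powM: "mat_pow M (Suc i) = (mat 1 - E) ** mat_pow T (Suc i)" for i
  proof (induction i)
    case (Suc i)
    then show ?case
      using TE by (simp add: M_def matrix_mul_distribs matrix_mul_eq_assoc[OF TE] flip: matrix_mul_assoc)
  qed (simp add: M_def)
  have "p ** S ** M = p ** (S ** T) - p ** (S ** E) ** T"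
    by (simp add: M_def matrix_mul_distribs matrix_mul_assoc)
  also have "p ** (S ** T) = - N"
    by (simp add: ST p_def matrix_mul_distribs e eE eN)
  also have "p ** (S ** E) = S ** E"
    using eSE by (simp add: p_def matrix_mul_distribs matrix_mul_assoc)
  finally have pSM: "p ** (S ** M) = - (S ** E ** T) - N"
    by (simp add: matrix_mul_assoc)
  have summand: "mat_pow A i ** p ** S ** mat_pow M (i + 2)
      = - (mat_pow A i ** S ** E ** mat_pow T (i + 2)) - mat_pow A i ** N ** mat_pow T (i + 1)" for i
  proof -
    \<comment> \<open>One \<open>M\<close> is split off to form \<open>p ** (S ** M)\<close>, and
      \<open>M ** E = 0\<close> absorbs the remaining \<open>mat 1 - E\<close>. The \<open>T\<close>
      inside \<open>pSM\<close> then raises the exponent to \<open>i + 2\<close> in the first term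
      only.\<close>
    have "mat_pow A i ** p ** S ** mat_pow M (i + 2)
        = mat_pow A i ** (p ** (S ** M)) ** mat_pow T (i + 1)"
    proof -
      have "mat_pow M (i + 2) = M ** mat_pow M (Suc i)"
        by simp
      also have "\<dots> = M ** mat_pow T (i + 1)"
        unfolding powM by (simp add: matrix_mul_distribs matrix_mul_eq_assoc[OF ME] del: mat_pow.simps(2))
      finally show ?thesis
        by (simp add: matrix_mul_assoc)
    qed
    then show ?thesis
      unfolding pSM by (simp add: matrix_mul_distribs matrix_mul_minus matrix_mul_assoc)
  qed
  have "drazin S = M + (\<Sum>i<k. mat_pow A i ** p ** S ** mat_pow M (i + 2))"
    by (rule drazin_nilpotent_perturbation) (fact p_def e Ae nil Sp eE Ee eM Me ME EaM eSM MSe eSE)+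
  also have "\<dots> = M - (\<Sum>i<k. mat_pow A i ** S ** E ** mat_pow T (i + 2))
      - (\<Sum>i<k. mat_pow A i ** N ** mat_pow T (i + 1))"
    unfolding summand by (simp add: sum_subtractf sum_negf)
  finally show ?thesis
    by (simp add: M_def T_def E_def N_def a_def d_def g_def matrix_mul_assoc)
qed

end
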